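(* Let $F$ be an algebraically closed field and let $n>1$ be an integer. If $S$ is an irredundant generating set for $\mathrm{M}_n(F)$, then $$|S|\leq \mathrm{indep}_{\mathrm{GL}_n(F)}\mathrm{Sub}(F^n).$$ More precisely, one can construct from $S$ a $\mathrm{GL}_n(F)$-independent set $S'\subseteq \mathrm{Sub}(F^n)$ with $|S'|=|S|$ as follows: for every $a\in S$, there exists a subspace $V_a\subseteq F^n$ that is invariant under every $b\in S-\{a\}$ and not invariant under $a$; and for any choice of such subspaces $V_a$ $(a\in S)$, the set $S'=\{V_a : a\in S\}$ is $\mathrm{GL}_n(F)$-independent and satisfies $|S'|=|S|$.
   Context: A subset $S\subseteq \mathrm{M}_n(F)$ is called an irredundant generating set for $\mathrm{M}_n(F)$ if $S$ generates $\mathrm{M}_n(F)$ as a unital $F$-algebra and no proper subset of $S$ does. A subspace $V\subseteq F^n$ is invariant under $a\in \mathrm{M}_n(F)$ if $a(V)\subseteq V$. $\mathrm{Sub}(F^n)$ denotes the set of all $F$-subspaces of $F^n$, on which $\mathrm{GL}_n(F)$ acts by $g\cdot V=g(V)$. A subset $T\subseteq \mathrm{Sub}(F^n)$ is called $\mathrm{GL}_n(F)$-independent if for every $V\in T$ there is $g\in \mathrm{GL}_n(F)$ such that $g(U)=U$ for every $U\in T-\{V\}$, but $g(V)\neq V$. $\mathrm{indep}_{\mathrm{GL}_n(F)}\mathrm{Sub}(F^n)$ is the largest possible size of a $\mathrm{GL}_n(F)$-independent subset of $\mathrm{Sub}(F^n)$. *)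

theory Defs
  imports
    "HOL-Analysis.Analysis"
    "HOL-Computational_Algebra.Polynomial"
    "HOL-Library.Equipollence"
    "HOL-Library.Extended_Nat"
begin

text \<open>
  Throughout, \<open>F\<^sup>n\<close> is the type \<open>'a ^ 'n\<close> and \<open>M\<^sub>n(F)\<close> is the type \<open>'a ^ 'n ^ 'n\<close>,
  with \<open>n = CARD('n)\<close>; matrices act on column vectors from the left.
\<close>

subsection \<open>Irredundant generating sets of the matrix algebra\<close>

definition unital_subalgebra :: "('a::field ^ 'n::finite ^ 'n) set \<Rightarrow> bool" where
  "unital_subalgebra A \<longleftrightarrow>
     mat 1 \<in> A \<and>
     (\<forall>x\<in>A. \<forall>y\<in>A. x + y \<in> A) \<and>
     (\<forall>c. \<forall>x\<in>A. (\<chi> i j. c * x $ i $ j) \<in> A) \<and>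
     (\<forall>x\<in>A. \<forall>y\<in>A. x ** y \<in> A)"

definition generates_matrix_algebra :: "('a::field ^ 'n::finite ^ 'n) set \<Rightarrow> bool" where
  "generates_matrix_algebra S \<longleftrightarrow> unital_subalgebra hull S = UNIV"

definition irredundant_generating_set :: "('a::field ^ 'n::finite ^ 'n) set \<Rightarrow> bool" where
  "irredundant_generating_set S \<longleftrightarrow>
     generates_matrix_algebra S \<and> (\<forall>T. T \<subset> S \<longrightarrow> \<not> generates_matrix_algebra T)"

definition invariant_under :: "('a::field ^ 'n::finite) set \<Rightarrow> 'a ^ 'n ^ 'n \<Rightarrow> bool" where
  "invariant_under V a \<longleftrightarrow> (*v) a ` V \<subseteq> V"

subsection \<open>Independent sets of subspaces\<close>

definition GL_independent :: "('a::field ^ 'n::finite) set set \<Rightarrow> bool" where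
  "GL_independent T \<longleftrightarrow>
     (\<forall>V\<in>T. vec.subspace V) \<and>
     (\<forall>V\<in>T. \<exists>g :: 'a ^ 'n ^ 'n. invertible g \<and>
        (\<forall>U\<in>T - {V}. (*v) g ` U = U) \<and> (*v) g ` V \<noteq> V)"

text \<open>
  \<open>card\<close> is \<open>0\<close> on infinite sets, so sizes are measured in \<open>enat\<close>.
\<close>

definition set_size :: "'b set \<Rightarrow> enat" where
  "set_size X = (if finite X then enat (card X) else \<infinity>)"

text \<open>
  The largest size of an independent set, taken as a supremum in \<open>enat\<close>. The type argument
  carries \<open>F\<close> and \<open>n\<close>. The supremum is a maximum: the stabilizers of larger and larger
  parts of an independent set are the unit groups of a strictly descending chain of
  subalgebras of \<open>M\<^sub>n(F)\<close>, so the sizes are at most \<open>n\<^sup>2\<close>.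
\<close>

definition indep_GL_Sub :: "('a::field ^ 'n::finite) itself \<Rightarrow> enat" where
  "indep_GL_Sub _ = (SUP T \<in> {T :: ('a ^ 'n) set set. GL_independent T}. set_size T)"

end

theory Submission
  imports Defs
begin

text \<open>
  By Burnside's theorem the proper subalgebra generated by \<open>S - {a}\<close> has a nontrivial invariant subspace
  that \<open>S\<close>, which generates everything, cannot leave invariant. For independence, \<open>1 + \<mu> a\<close>
  preserves the same subspaces as \<open>a\<close> when \<open>\<mu> \<noteq> 0\<close>, and it is invertible for almost all \<open>\<mu>\<close>,
  because its determinant is a polynomial in \<open>\<mu>\<close> with value \<open>1\<close> at \<open>0\<close>; so such a matrix moves
  \<open>V\<^sub>a\<close> and fixes the other subspaces. Burnside's theorem is proved after Lomonosov and
  Rosenthal: in an irreducible algebra, a nonzero element with kernel of maximal dimension has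
  rank one.
\<close>

text \<open>Names the scalar multiple that \<open>unital_subalgebra\<close> writes out, so that
  rewrite rules can be stated for it.\<close>

definition mat_scale :: "'a::field \<Rightarrow> 'a ^ 'n ^ 'm \<Rightarrow> 'a ^ 'n ^ 'm" where
  "mat_scale c x = (\<chi> i j. c * x $ i $ j)"

lemma mat_scale_mult_vec: "mat_scale c x *v v = c *s (x *v v)"
  by (simp add: mat_scale_def matrix_vector_mult_def vec_eq_iff sum_distrib_left mult.assoc)

subsection \<open>Eigenvectors in invariant subspaces\<close>

text \<open>The vector \<open>p(B) v\<close>, evaluated by Horner's scheme and so without powers of
  the matrix.\<close>

definition poly_vec :: "'a::field ^ 'n ^ 'n \<Rightarrow> 'a poly \<Rightarrow> 'a ^ 'n \<Rightarrow> 'a ^ 'n" where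
  "poly_vec B p v = fold_coeffs (\<lambda>c x. c *s v + B *v x) p 0"

lemma poly_vec_0 [simp]: "poly_vec B 0 v = 0"
  by (simp add: poly_vec_def)

lemma poly_vec_pCons [simp]: "poly_vec B (pCons c p) v = c *s v + B *v poly_vec B p v"
  by (cases "c = 0 \<and> p = 0") (auto simp: poly_vec_def)

lemma poly_vec_add: "poly_vec B (p + q) v = poly_vec B p v + poly_vec B q v"
  by (induction p q rule: poly_induct2)
     (simp_all add: vec.add vec.scale_left_distrib algebra_simps)

lemma poly_vec_smult: "poly_vec B (smult c p) v = c *s poly_vec B p v"
  by (induction p) (simp_all add: vec.scale vec.scale_right_distrib)

lemma poly_vec_sum: "poly_vec B (sum f A) v = (\<Sum>i\<in>A. poly_vec B (f i) v)"
  by (induction A rule: infinite_finite_induct) (simp_all add: poly_vec_add)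

lemma poly_vec_monom: "poly_vec B (monom c n) v = c *s (((*v) B ^^ n) v)"
  by (induction n) (simp_all add: monom_0 monom_Suc vec.scale)

lemma poly_vec_in_invariant:
  assumes "vec.subspace W" "invariant_under W B" "v \<in> W"
  shows "poly_vec B p v \<in> W"
  using assms
  by (induction p)
     (auto simp: invariant_under_def vec.subspace_0 intro!: vec.subspace_add vec.subspace_scale)

text \<open>The n + 1 iterates v, B v, ..., B^n v lie in a space of dimension n, and a linear
  relation between them is a polynomial.\<close>

lemma exists_annihilating_poly:
  fixes B :: "'a::field ^ 'n ^ 'n"
  shows "\<exists>p. p \<noteq> 0 \<and> poly_vec B p v = 0"
proof -
  define f where "f i = ((*v) B ^^ i) v" for i :: nat
  have pf: "poly_vec B (\<Sum>i\<in>I. monom (c i) i) v = (\<Sum>i\<in>I. c i *s f i)" for c and I :: "nat set"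
    by (simp add: poly_vec_sum poly_vec_monom f_def)
  \<comment> \<open>Linear dependence is a property of sets and does not see repeated vectors. A
    repetition among the iterates is therefore treated first; it gives X^i - X^j.\<close>
  show ?thesis
  proof (cases "inj f")
    case False
    then obtain i j where ij: "i \<noteq> j" "f i = f j" by (auto simp: inj_def)
    let ?p = "monom 1 i + monom (-1) j :: 'a poly"
    have "poly_vec B ?p v = f i + (- 1) *s f j"
      by (simp add: poly_vec_add poly_vec_monom f_def)
    hence "poly_vec B ?p v = 0" using ij(2) by (simp add: vec_eq_iff)
    moreover have "coeff ?p i \<noteq> 0" using ij by simp
    ultimately show ?thesis by (metis coeff_0)
  next
    case True
    let ?I = "{..CARD('n)}"
    have "card (f ` ?I) = Suc (CARD('n))"
      using True by (simp add: card_image inj_on_subset)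
    hence "vec.dependent (f ` ?I)"
      using vec.independent_card_le_dim[of "f ` ?I" UNIV] by (auto simp: card_cart_basis)
    then obtain u where u: "\<exists>x\<in>f ` ?I. u x \<noteq> 0" "(\<Sum>x\<in>f ` ?I. u x *s x) = 0"
      by (auto simp: vec.dependent_finite)
    let ?p = "\<Sum>i\<in>?I. monom (u (f i)) i"
    have "poly_vec B ?p v = 0"
      using u(2) True by (simp add: pf sum.reindex inj_on_subset)
    moreover obtain i where i: "i \<in> ?I" "u (f i) \<noteq> 0" using u(1) by auto
    have "coeff ?p i = u (f i)" using i(1) by (simp add: coeff_sum)
    ultimately show ?thesis using i(2) by (metis coeff_0)
  qed
qed

text \<open>Split off a root: p = (X - \<mu>) q. Then q(B) v is killed by B - \<mu>, so it is an
  eigenvector unless it vanishes, and in that case q replaces p. The form q(B) v keeps the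
  eigenvector inside every invariant subspace that contains v.\<close>

lemma eigenvector_from_annihilating_poly:
  fixes B :: "'a::alg_closed_field ^ 'n ^ 'n"
  assumes "p \<noteq> 0" "poly_vec B p v = 0" "v \<noteq> 0"
  shows "\<exists>q \<mu>. poly_vec B q v \<noteq> 0 \<and> B *v poly_vec B q v = \<mu> *s poly_vec B q v"
  using assms(1,2)
proof (induction "degree p" arbitrary: p rule: less_induct)
  case less
  \<comment> \<open>A nonzero constant cannot annihilate v, so the descent stops before the degree
    reaches 0.\<close>
  have "degree p > 0"
  proof (rule ccontr)
    assume "\<not> degree p > 0"
    then obtain c where "p = [:c:]" by (metis degree_eq_zeroE gr0I)
    with less.prems assms(3) show False by simp
  qed
  then obtain \<mu> where "poly p \<mu> = 0" using alg_closed_imp_poly_has_root by blast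
  then obtain q where q: "p = [:-\<mu>, 1:] * q" by (auto simp: poly_eq_0_iff_dvd)
  with less.prems have "q \<noteq> 0" by auto
  hence deg: "degree q < degree p" unfolding q by (subst degree_mult_eq) auto
  have "p = smult (-\<mu>) q + pCons 0 q" by (simp add: q)
  hence "poly_vec B p v = B *v poly_vec B q v - \<mu> *s poly_vec B q v"
    by (simp only: poly_vec_add poly_vec_smult poly_vec_pCons) simp
  with less.prems have eig: "B *v poly_vec B q v = \<mu> *s poly_vec B q v" by simp
  show ?case
    using less.hyps[OF deg \<open>q \<noteq> 0\<close>] eig by blast
qed

lemma eigenvector_in_invariant_subspace:
  fixes B :: "'a::alg_closed_field ^ 'n ^ 'n"
  assumes "vec.subspace W" "invariant_under W B" "v \<in> W" "v \<noteq> 0"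
  obtains u \<mu> where "u \<in> W" "u \<noteq> 0" "B *v u = \<mu> *s u"
  using exists_annihilating_poly[of B v] eigenvector_from_annihilating_poly[of _ B v]
    poly_vec_in_invariant[OF assms(1-3)] assms(4) by metis

subsection \<open>Burnside's theorem\<close>

text \<open>A linear functional that vanishes on W and not at some x outside W is the dot product
  with a vector v.\<close>

lemma proper_subspace_annihilator:
  fixes W :: "('a::field ^ 'n) set"
  assumes "vec.subspace W" "W \<noteq> UNIV"
  obtains v where "v \<noteq> 0" "\<forall>w\<in>W. (\<Sum>i\<in>UNIV. v $ i * w $ i) = 0"
proof -
  obtain x where x: "x \<notin> W" using assms(2) by blast
  obtain B where B: "B \<subseteq> W" "vec.independent B" "W \<subseteq> vec.span B"
    using vec.maximal_independent_subset by blast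
  have span: "vec.span B = W"
    using B assms(1) by (metis vec.span_minimal subset_antisym)
  hence "vec.independent (insert x B)" using B x by (simp add: vec.independent_insert)
  \<comment> \<open>The value \<open>1\<close> is the all-ones vector, so every row of the matrix of
    f is a functional with value 1 at x and 0 on W. The index \<open>undefined\<close> below just
    selects one row.\<close>
  then obtain f :: "'a ^ 'n \<Rightarrow> 'a ^ 'n" where f: "Vector_Spaces.linear (*s) (*s) f"
      "\<forall>y\<in>insert x B. f y = (if y = x then 1 else 0)"
    using vec.linear_independent_extend[of "insert x B" "\<lambda>y. if y = x then 1 else 0"] by blast
  have x_B: "x \<notin> B" using x B(1) by blast
  let ?v = "matrix f $ undefined"
  have f_row: "f y $ undefined = (\<Sum>i\<in>UNIV. ?v $ i * y $ i)" for y
    using matrix_works[OF f(1), of y] by (auto simp: matrix_vector_mult_def vec_eq_iff)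
  have "f y = 0" if "y \<in> B" for y using that f(2) x_B by auto
  hence "f w = 0" if "w \<in> W" for w
    using vec.linear_eq_0_on_span[OF f(1), of B w] that span by blast
  moreover have "?v \<noteq> 0" using f_row[of x] f(2) by auto
  ultimately show thesis using that[of ?v] f_row by (metis zero_index)
qed

section \<open>Closure properties of unital subalgebras\<close>

lemma unital_subalgebra_scale:
  "unital_subalgebra A \<Longrightarrow> x \<in> A \<Longrightarrow> mat_scale c x \<in> A"
  by (simp add: unital_subalgebra_def mat_scale_def)

lemma unital_subalgebra_add:
  "unital_subalgebra A \<Longrightarrow> x \<in> A \<Longrightarrow> y \<in> A \<Longrightarrow> x + y \<in> A"
  by (simp add: unital_subalgebra_def)

lemma unital_subalgebra_mult:
  "unital_subalgebra A \<Longrightarrow> x \<in> A \<Longrightarrow> y \<in> A \<Longrightarrow> x ** y \<in> A"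
  by (simp add: unital_subalgebra_def)

lemma unital_subalgebra_one: "unital_subalgebra A \<Longrightarrow> mat 1 \<in> A"
  by (simp add: unital_subalgebra_def)

lemma unital_subalgebra_zero:
  assumes "unital_subalgebra A" shows "0 \<in> A"
proof -
  have "mat_scale 0 (mat 1 :: 'a ^ 'b ^ 'b) = 0" by (simp add: mat_scale_def vec_eq_iff)
  thus ?thesis using unital_subalgebra_scale[OF assms unital_subalgebra_one[OF assms], of 0] by simp
qed

lemma unital_subalgebra_sum:
  "unital_subalgebra A \<Longrightarrow> (\<And>i. i \<in> I \<Longrightarrow> f i \<in> A) \<Longrightarrow> sum f I \<in> A"
  by (induction I rule: infinite_finite_induct)
     (auto simp: unital_subalgebra_zero unital_subalgebra_add)

lemma unital_subalgebra_stabilizer: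
  assumes "vec.subspace V"
  shows "unital_subalgebra {x. invariant_under V x}"
  using assms
  by (auto simp: unital_subalgebra_def invariant_under_def image_subset_iff
      matrix_vector_mult_add_rdistrib vec.subspace_add vec.subspace_scale
      mat_scale_mult_vec[unfolded mat_scale_def] simp flip: matrix_vector_mul_assoc)

definition outer :: "'a::field ^ 'n \<Rightarrow> 'a ^ 'n \<Rightarrow> 'a ^ 'n ^ 'n" where
  "outer z w = (\<chi> i j. z $ i * w $ j)"

text \<open>Irreducibility makes A transitive on nonzero vectors. Multiplying one element of rank
  one from both sides by elements of A then gives all outer products, and these span the
  matrices.\<close>

theorem burnside:
  fixes A :: "('a::alg_closed_field ^ 'n ^ 'n) set"
  assumes A: "unital_subalgebra A"
    and irr: "\<And>V. vec.subspace V \<Longrightarrow> (\<forall>a\<in>A. invariant_under V a) \<Longrightarrow> V = {0} \<or> V = UNIV"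
  shows "A = UNIV"
proof -
  \<comment> \<open>The orbit A y is an invariant subspace, and it contains y because A contains the
    identity.\<close>
  have transitive: "\<exists>a\<in>A. a *v y = z" if "y \<noteq> 0" for y z
  proof -
    let ?V = "(\<lambda>a. a *v y) ` A"
    have "vec.subspace ?V"
    proof (rule vec.subspaceI)
      show "0 \<in> ?V" using unital_subalgebra_zero[OF A] by force
    next
      fix p q assume "p \<in> ?V" "q \<in> ?V"
      then obtain a b where "a \<in> A" "b \<in> A" "p = a *v y" "q = b *v y" by blast
      thus "p + q \<in> ?V"
        by (auto simp flip: matrix_vector_mult_add_rdistrib intro!: unital_subalgebra_add[OF A])
    next
      fix p c assume "p \<in> ?V"
      then obtain a where "a \<in> A" "p = a *v y" by blast
      thus "c *s p \<in> ?V"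
        by (auto simp flip: mat_scale_mult_vec intro!: unital_subalgebra_scale[OF A])
    qed
    moreover have "\<forall>a\<in>A. invariant_under ?V a"
      by (auto simp: invariant_under_def matrix_vector_mul_assoc intro!: unital_subalgebra_mult[OF A])
    moreover have "y \<in> ?V" using unital_subalgebra_one[OF A] by force
    ultimately have "?V = UNIV" using irr[of ?V] that by auto
    thus ?thesis by (metis UNIV_I imageE)
  qed
  define ker where "ker T = {x. T *v x = 0}" for T :: "'a ^ 'n ^ 'n"
  have sub_ker: "vec.subspace (ker T)" for T
    unfolding ker_def by (rule vec.subspace_kernel)
  define N where "N T \<longleftrightarrow> T \<in> A \<and> T \<noteq> 0" for T
  have "(mat 1 :: 'a ^ 'n ^ 'n) \<noteq> 0" by (simp add: mat_def vec_eq_iff)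
  hence "N (mat 1)" using unital_subalgebra_one[OF A] by (simp add: N_def)
  moreover have "\<forall>T. N T \<longrightarrow> vec.dim (ker T) < Suc (CARD('n))"
    using vec.dim_subset_UNIV by (auto simp: less_Suc_eq_le vec.dimension_def card_cart_basis)
  \<comment> \<open>Kernel dimensions are at most n, so some nonzero T in A has a kernel of maximal
    dimension.\<close>
  ultimately obtain T where T: "N T" and T_max: "\<And>S. N S \<Longrightarrow> vec.dim (ker S) \<le> vec.dim (ker T)"
    using ex_has_greatest_nat[of N "mat 1" "\<lambda>T. vec.dim (ker T)"] by blast
  obtain x1 where x1: "T *v x1 \<noteq> 0" using T by (auto simp: N_def matrix_eq)
  define y where "y = T *v x1"
  have rank1: "\<exists>c. T *v x2 = c *s y" for x2
  proof (rule ccontr)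
    assume indep: "\<not> ?thesis"
    obtain a where a: "a \<in> A" "a *v y = x2" using transitive x1 y_def by blast
    \<comment> \<open>The matrix T a maps everything into the range of T, so it has an eigenvector u
      = T x there.\<close>
    let ?W = "range ((*v) T)"
    have W: "vec.subspace ?W" by (rule vec.subspace_image) simp
    moreover have "invariant_under ?W (T ** a)"
      by (auto simp: invariant_under_def simp flip: matrix_vector_mul_assoc)
    moreover have "y \<in> ?W" "y \<noteq> 0" using x1 by (auto simp: y_def)
    ultimately obtain u \<mu> where u: "u \<in> ?W" "u \<noteq> 0" "(T ** a) *v u = \<mu> *s u"
      by (rule eigenvector_in_invariant_subspace)
    \<comment> \<open>S = (T a - \<mu>) T vanishes on the kernel of T and also at x, where T x = u
      is nonzero. By assumption S x1 = T x2 - \<mu> y is not 0, so S contradicts the maximality of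
      the kernel of T.\<close>
    define S where "S = T ** a ** T + mat_scale (-\<mu>) T"
    have S_vec: "S *v x = (T ** a) *v (T *v x) - \<mu> *s (T *v x)" for x
      by (simp add: S_def matrix_vector_mult_add_rdistrib mat_scale_mult_vec matrix_vector_mul_assoc)
    have "S \<in> A" using T a A unfolding S_def N_def
      by (intro unital_subalgebra_add unital_subalgebra_mult unital_subalgebra_scale) auto
    moreover have "S *v x1 \<noteq> 0"
      using indep a by (auto simp: S_vec simp flip: y_def matrix_vector_mul_assoc)
    ultimately have "N S" by (auto simp: N_def)
    obtain x where x: "u = T *v x" using u(1) by blast
    have "ker T \<subset> ker S"
    proof
      show "ker T \<subseteq> ker S" by (auto simp: ker_def S_vec)
      show "ker T \<noteq> ker S" using u x by (auto simp: ker_def S_vec set_eq_iff)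
    qed
    hence "vec.dim (ker T) < vec.dim (ker S)"
      using sub_ker by (intro vec.dim_psubset) (simp add: vec.span_eq_iff[THEN iffD2])
    with T_max[OF \<open>N S\<close>] show False by simp
  qed
  obtain k where k: "y $ k \<noteq> 0" using x1 by (auto simp: y_def vec_eq_iff)
  \<comment> \<open>All columns of T are multiples of y, and row k gives the factors since
    \<open>y $ k\<close> is not 0.\<close>
  define \<phi> where "\<phi> = (\<chi> j. T $ k $ j / y $ k)"
  have T_outer: "T = outer y \<phi>"
  proof -
    have "outer y \<phi> $ i $ j = T $ i $ j" for i j
    proof -
      obtain c where "T *v axis j 1 = c *s y" using rank1 by blast
      moreover have "(T *v axis j 1) $ i = T $ i $ j" for i
        by (simp add: matrix_vector_mult_def axis_def if_distrib cong: if_cong)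
      ultimately have "T $ i $ j = c * y $ i" for i
        by simp
      thus ?thesis using k by (simp add: outer_def \<phi>_def)
    qed
    thus ?thesis by (simp add: vec_eq_iff)
  qed
  have \<phi>: "\<phi> \<noteq> 0" using T by (auto simp: N_def T_outer outer_def vec_eq_iff)
  have outer_mult: "a ** outer z w ** b = outer (a *v z) (transpose b *v w)" for a b z w
    by (simp add: outer_def matrix_matrix_mult_def matrix_vector_mult_def transpose_def vec_eq_iff
        sum_distrib_left sum_distrib_right mult_ac) (intro allI sum.swap)
  \<comment> \<open>Right multiplication by b replaces \<phi> by its image under the transpose of b;
    these images must fill the whole space.\<close>
  let ?W = "(\<lambda>b. transpose b *v \<phi>) ` A"
  have W_UNIV: "?W = UNIV"
  proof (rule ccontr)
    assume proper: "?W \<noteq> UNIV"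
    have "vec.subspace ?W"
    proof (rule vec.subspaceI)
      show "0 \<in> ?W" using unital_subalgebra_zero[OF A]
        by (intro image_eqI[of _ _ 0]) (auto simp: transpose_def matrix_vector_mult_def vec_eq_iff)
    next
      fix p q assume "p \<in> ?W" "q \<in> ?W"
      then obtain a b where "a \<in> A" "b \<in> A" "p = transpose a *v \<phi>" "q = transpose b *v \<phi>"
        by blast
      moreover have "transpose (a + b) = transpose a + transpose b"
        by (simp add: transpose_def vec_eq_iff)
      ultimately show "p + q \<in> ?W"
        using unital_subalgebra_add[OF A, of a b]
        by (intro image_eqI[of _ _ "a + b"]) (simp_all add: matrix_vector_mult_add_rdistrib)
    next
      fix p c assume "p \<in> ?W"
      then obtain a where "a \<in> A" "p = transpose a *v \<phi>" by blast
      moreover have "transpose (mat_scale c a) = mat_scale c (transpose a)"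
        by (simp add: transpose_def mat_scale_def vec_eq_iff)
      ultimately show "c *s p \<in> ?W"
        using unital_subalgebra_scale[OF A, of a c]
        by (intro image_eqI[of _ _ "mat_scale c a"]) (simp_all add: mat_scale_mult_vec)
    qed
    from this proper obtain v
      where v: "v \<noteq> 0" "\<forall>w\<in>?W. (\<Sum>i\<in>UNIV. v $ i * w $ i) = 0"
      by (rule proper_subspace_annihilator)
    \<comment> \<open>The dot product of v with the transpose of b applied to \<phi> equals that of
      \<phi> with b v. Transitivity on v itself makes b v any axis vector, so the transposed algebra
      needs no separate argument.\<close>
    have "\<phi> $ j = 0" for j
    proof -
      obtain b where b: "b \<in> A" "b *v v = axis j 1" using transitive[OF v(1)] by blast
      have "0 = (\<Sum>i\<in>UNIV. v $ i * (transpose b *v \<phi>) $ i)" using bspec[OF v(2) imageI[OF b(1)]] by simp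
      also have "\<dots> = (\<Sum>i\<in>UNIV. \<Sum>l\<in>UNIV. \<phi> $ l * (b $ l $ i * v $ i))"
        by (simp add: matrix_vector_mult_def transpose_def sum_distrib_left mult_ac)
      also have "\<dots> = (\<Sum>l\<in>UNIV. \<phi> $ l * (b *v v) $ l)"
        by (subst sum.swap) (simp add: matrix_vector_mult_def sum_distrib_left)
      also have "\<dots> = \<phi> $ j" by (simp add: b(2) axis_def if_distrib cong: if_cong)
      finally show ?thesis by simp
    qed
    with \<phi> show False by (simp add: vec_eq_iff)
  qed
  have outer_A: "outer z w \<in> A" for z w
  proof -
    have "w \<in> ?W" by (simp only: W_UNIV UNIV_I)
    then obtain b where b: "b \<in> A" "w = transpose b *v \<phi>" by blast
    obtain a where a: "a \<in> A" "a *v y = z" using transitive x1 y_def by blast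
    have "a ** T ** b \<in> A" using A T a b by (intro unital_subalgebra_mult) (auto simp: N_def)
    thus ?thesis by (simp add: T_outer outer_mult a b)
  qed
  have "M \<in> A" for M
  proof -
    \<comment> \<open>M is assembled from its rows.\<close>
    have "(\<Sum>i\<in>UNIV. outer (axis i 1) (M $ i)) = M"
      by (simp add: vec_eq_iff outer_def axis_def if_distrib if_distribR cong: if_cong)
    thus ?thesis using unital_subalgebra_sum[OF A, of UNIV "\<lambda>i. outer (axis i 1) (M $ i)"] outer_A
      by simp
  qed
  thus ?thesis by blast
qed

subsection \<open>Independence\<close>

text \<open>Over a finite field, 1 plus the product of all X - x takes the value 1 everywhere, so it
  is a nonconstant polynomial without a root.\<close>

lemma infinite_UNIV_alg_closed_field: "infinite (UNIV :: 'a::alg_closed_field set)"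
proof
  assume fin: "finite (UNIV :: 'a set)"
  let ?p = "(\<Prod>x\<in>UNIV. [:-x, 1:]) :: 'a poly"
  have deg: "degree ?p = card (UNIV :: 'a set)"
    by (subst degree_prod_eq_sum_degree) auto
  have "card (UNIV :: 'a set) > 0" using fin by (simp add: card_gt_0_iff)
  hence "degree (?p + 1) > 0" using deg by (subst degree_add_eq_left) auto
  then obtain z where "poly (?p + 1) z = 0" using alg_closed_imp_poly_has_root by blast
  moreover have "poly ?p z = 0" using fin by (auto simp: poly_prod prod_zero_iff)
  ultimately show False by simp
qed

section \<open>Invertible matrices with the invariant subspaces of a given matrix\<close>

lemma invertible_one_plus_scale:
  fixes a :: "'a::field ^ 'n ^ 'n"
  assumes "infinite (UNIV :: 'a set)"
  obtains \<mu> where "\<mu> \<noteq> 0" "invertible (mat 1 + mat_scale \<mu> a)"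
proof -
  \<comment> \<open>P is 1 + X a over the polynomial ring; evaluation at \<mu> commutes with the
    determinant.\<close>
  define P :: "'a poly ^ 'n ^ 'n" where "P = (\<chi> i j. [:if i = j then 1 else 0, a $ i $ j:])"
  have poly_P: "poly (det P) \<mu> = det (mat 1 + mat_scale \<mu> a)" for \<mu>
  proof -
    have "(mat 1 + mat_scale \<mu> a) $ i $ j = poly (P $ i $ j) \<mu>" for i j
      by (simp add: P_def mat_def mat_scale_def)
    thus ?thesis by (simp add: det_def poly_sum poly_prod)
  qed
  have "mat_scale 0 a = 0" by (simp add: mat_scale_def vec_eq_iff)
  hence "poly (det P) 0 = 1" by (simp add: poly_P)
  hence "det P \<noteq> 0" by auto
  hence "finite (insert 0 {\<mu>. poly (det P) \<mu> = 0})" by (simp add: poly_roots_finite)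
  then obtain \<mu> where "\<mu> \<notin> insert 0 {\<mu>. poly (det P) \<mu> = 0}"
    using assms ex_new_if_finite by blast
  thus thesis using that[of \<mu>] by (simp add: poly_P invertible_det_nz)
qed

lemma invariant_under_one_plus_scale_iff:
  assumes "vec.subspace V" "\<mu> \<noteq> 0"
  shows "invariant_under V (mat 1 + mat_scale \<mu> a) \<longleftrightarrow> invariant_under V a"
proof -
  have "v + \<mu> *s (a *v v) \<in> V \<longleftrightarrow> a *v v \<in> V" if "v \<in> V" for v
  proof
    assume "v + \<mu> *s (a *v v) \<in> V"
    from vec.subspace_scale[OF assms(1) vec.subspace_diff[OF assms(1) this that], of "inverse \<mu>"]
    show "a *v v \<in> V" using assms(2) by simp
  qed (use that assms(1) in \<open>auto intro: vec.subspace_add vec.subspace_scale\<close>)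
  thus ?thesis
    by (auto simp: invariant_under_def image_subset_iff matrix_vector_mult_add_rdistrib
        mat_scale_mult_vec)
qed

text \<open>An injective map preserves dimension, so the image of V cannot be a proper subspace of
  V.\<close>

lemma invertible_image_eq_iff:
  fixes g :: "'a::field ^ 'n ^ 'n"
  assumes "vec.subspace V" "invertible g"
  shows "(*v) g ` V = V \<longleftrightarrow> invariant_under V g"
proof
  assume "invariant_under V g"
  hence sub: "(*v) g ` V \<subseteq> V" by (simp add: invariant_under_def)
  have "inj ((*v) g)" using assms(2) by (simp add: inj_matrix_vector_mult)
  hence "vec.dim ((*v) g ` V) = vec.dim V"
    by (intro vec.dim_image_eq) (auto intro: inj_on_subset)
  thus "(*v) g ` V = V"
    using sub assms(1) by (intro vec.subspace_dim_equal vec.subspace_image) auto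
qed (simp add: invariant_under_def)

lemma GL_independent_image:
  fixes S :: "('a::alg_closed_field ^ 'n ^ 'n) set" and V :: "'a ^ 'n ^ 'n \<Rightarrow> ('a ^ 'n) set"
  assumes sub: "\<And>a. a \<in> S \<Longrightarrow> vec.subspace (V a)"
    and inv: "\<And>a b. a \<in> S \<Longrightarrow> b \<in> S \<Longrightarrow> b \<noteq> a \<Longrightarrow> invariant_under (V a) b"
    and not_inv: "\<And>a. a \<in> S \<Longrightarrow> \<not> invariant_under (V a) a"
  shows "GL_independent (V ` S) \<and> V ` S \<approx> S"
proof
  \<comment> \<open>If V a = V b with a \<noteq> b, this subspace would be both invariant and not
    invariant under a.\<close>
  have "inj_on V S" using inv not_inv by (metis inj_onI)
  thus "V ` S \<approx> S" by (simp add: inj_on_image_eqpoll_self)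
  have "\<exists>g :: 'a ^ 'n ^ 'n. invertible g \<and> (\<forall>U\<in>V ` S - {V a}. (*v) g ` U = U) \<and> (*v) g ` V a \<noteq> V a"
    if a: "a \<in> S" for a
  proof -
    obtain \<mu> where \<mu>: "\<mu> \<noteq> 0" and g: "invertible (mat 1 + mat_scale \<mu> a)" (is "invertible ?g")
      using invertible_one_plus_scale[OF infinite_UNIV_alg_closed_field] by blast
    have "(*v) ?g ` V b = V b \<longleftrightarrow> b \<noteq> a" if "b \<in> S" for b
      using that a sub inv not_inv \<mu>
      by (auto simp: invertible_image_eq_iff[OF _ g] invariant_under_one_plus_scale_iff)
    with g a show ?thesis by (intro exI[of _ ?g]) auto
  qed
  with sub show "GL_independent (V ` S)" by (auto simp: GL_independent_def)
qed

text \<open>Irredundancy makes the algebra generated by \<open>S - {a}\<close> proper, so Burnside's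
  theorem applies to it. Were its invariant subspace V also invariant under a, the stabilizer of V
  would be a subalgebra containing S, hence everything.\<close>

lemma exists_distinguishing_subspace:
  fixes S :: "('a::alg_closed_field ^ 'n ^ 'n) set"
  assumes "irredundant_generating_set S" "a \<in> S"
  shows "\<exists>V. vec.subspace V \<and> (\<forall>b\<in>S - {a}. invariant_under V b) \<and> \<not> invariant_under V a"
proof -
  let ?A = "unital_subalgebra hull (S - {a})"
  have "unital_subalgebra ?A"
    by (rule hull_in) (auto simp: unital_subalgebra_def)
  moreover have "?A \<noteq> UNIV"
    using assms by (auto simp: irredundant_generating_set_def generates_matrix_algebra_def)
  ultimately have "\<exists>V. vec.subspace V \<and> (\<forall>x\<in>?A. invariant_under V x) \<and> \<not> (V = {0} \<or> V = UNIV)"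
    using burnside[of ?A] by metis
  then obtain V where V: "vec.subspace V" "\<forall>x\<in>?A. invariant_under V x" "V \<noteq> {0}" "V \<noteq> UNIV"
    by blast
  have inv: "\<forall>b\<in>S - {a}. invariant_under V b"
    using V(2) hull_subset[of "S - {a}" unital_subalgebra] by blast
  have "\<not> invariant_under V a"
  proof
    assume "invariant_under V a"
    hence "S \<subseteq> {x. invariant_under V x}" using inv by blast
    hence "unital_subalgebra hull S \<subseteq> {x. invariant_under V x}"
      using unital_subalgebra_stabilizer[OF V(1)] by (rule hull_minimal)
    hence all: "invariant_under V x" for x
      using assms by (auto simp: irredundant_generating_set_def generates_matrix_algebra_def)
    obtain v where v: "v \<in> V" "v \<noteq> 0" using V(1,3) vec.subspace_0 by blast
    then obtain k where k: "v $ k \<noteq> 0" by (auto simp: vec_eq_iff)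
    have "w \<in> V" for w
    proof -
      \<comment> \<open>Some matrix moves the nonzero v in V to any given w, so only the whole space
        could be invariant under all matrices.\<close>
      have "outer w (axis k (inverse (v $ k))) *v v = w"
        using k by (simp add: outer_def matrix_vector_mult_def axis_def vec_eq_iff if_distrib
            if_distribR cong: if_cong)
      thus ?thesis using all v(1) unfolding invariant_under_def by (metis image_subset_iff)
    qed
    with V(4) show False by blast
  qed
  with V(1) inv show ?thesis by blast
qed

lemma set_size_eqpoll: "A \<approx> B \<Longrightarrow> set_size A = set_size B"
  using eqpoll_finite_iff[of A B] eqpoll_iff_card[of A B] by (auto simp: set_size_def)

theorem proposition4p1:
  fixes S :: "('a::alg_closed_field ^ 'n::finite ^ 'n) set"
  assumes "CARD('n) > 1"
    and "irredundant_generating_set S"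
  shows "set_size S \<le> indep_GL_Sub TYPE('a ^ 'n)
    \<and> (\<forall>a\<in>S. \<exists>V. vec.subspace V \<and> (\<forall>b\<in>S - {a}. invariant_under V b) \<and> \<not> invariant_under V a)
    \<and> (\<forall>V :: 'a ^ 'n ^ 'n \<Rightarrow> ('a ^ 'n) set.
         (\<forall>a\<in>S. vec.subspace (V a) \<and> (\<forall>b\<in>S - {a}. invariant_under (V a) b)
                  \<and> \<not> invariant_under (V a) a)
         \<longrightarrow> GL_independent (V ` S) \<and> V ` S \<approx> S)"
proof (intro conjI)
  show exV: "\<forall>a\<in>S. \<exists>V. vec.subspace V \<and> (\<forall>b\<in>S - {a}. invariant_under V b) \<and> \<not> invariant_under V a"
    using exists_distinguishing_subspace[OF assms(2)] by blast
  show indep: "\<forall>V :: 'a ^ 'n ^ 'n \<Rightarrow> ('a ^ 'n) set.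
         (\<forall>a\<in>S. vec.subspace (V a) \<and> (\<forall>b\<in>S - {a}. invariant_under (V a) b)
                  \<and> \<not> invariant_under (V a) a)
         \<longrightarrow> GL_independent (V ` S) \<and> V ` S \<approx> S"
    by (intro allI impI GL_independent_image) auto
  \<comment> \<open>A choice of subspaces gives an independent set as large as S, over which the
    supremum is taken.\<close>
  from bchoice[OF exV] obtain V :: "'a ^ 'n ^ 'n \<Rightarrow> ('a ^ 'n) set" where
    "\<forall>a\<in>S. vec.subspace (V a) \<and> (\<forall>b\<in>S - {a}. invariant_under (V a) b)
      \<and> \<not> invariant_under (V a) a" ..
  with indep have V: "GL_independent (V ` S)" "V ` S \<approx> S" by simp_all
  have "set_size (V ` S) \<le> indep_GL_Sub TYPE('a ^ 'n)"
    unfolding indep_GL_Sub_def using V(1) by (intro SUP_upper) simp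
  thus "set_size S \<le> indep_GL_Sub TYPE('a ^ 'n)"
    using set_size_eqpoll[OF V(2)] by simp
qed

end
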